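(* Let $n$ be an even integer with $n>4$ and let $G=D_{2n}$ be the dihedral group of order $2n$. Then there is a polynomial $f(x)$ of degree $8$ such that the characteristic polynomial of the non-commuting graph of $G\times G$ is $$P_{\Gamma_{G\times G}}(x)=\frac{(-x)^{\frac{15n^2}{4}-2n-3}}{(-x)^{4}}\,(-x-4)^{\frac{n^2}{4}-n+1}\,\bigl(-x^{3}-(2n+4)x^{2}+16n(n-2)\bigr)^{n-2}f(x).$$ Moreover, if $\gamma_1,\dots,\gamma_8$ are the roots of $f(x)$ and $\alpha_1,\alpha_2,\alpha_3$ are the roots of $-x^{3}-(2n+4)x^{2}+16n(n-2)$, then the spectrum of $\Gamma_{G\times G}$ (eigenvalues in the first row, multiplicities in the second row, counted as a multiset) is $$\mathrm{spec}(\Gamma_{G\times G})=\begin{pmatrix} -4 & 0 & \alpha_1 & \alpha_2 & \alpha_3 & \gamma_1 & \gamma_2 & \cdots & \gamma_8\\ \frac{n^2}{4}-n+1 & \frac{15n^2}{4}-2n-7 & n-2 & n-2 & n-2 & 1 & 1 & \cdots & 1\end{pmatrix}.$$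
   Context: For a finite non-abelian group $G$ with center $Z(G)$, the non-commuting graph $\Gamma_G=\Gamma(G)$ is the simple graph with vertex set $G\setminus Z(G)$ in which two vertices $x,y$ are adjacent if and only if $xy\ne yx$. $P_{\Gamma}(x)=\det(xI-A)$ is the characteristic polynomial of the adjacency matrix $A$ of $\Gamma$ (here the number of vertices is even, so this equals $\det(A-xI)$). The spectrum of $\Gamma$ is the multiset of eigenvalues of $A$ with multiplicities. *)

theory Defs
  imports
    "HOL-Algebra.Coset"
    "Graph_Theory.Pair_Digraph"
    "Jordan_Normal_Form.Spectral_Radius"
begin

hide_const (open) Coset.order

section \<open>Dihedral groups\<close>

text \<open>
  The dihedral group \<open>\<langle>r, s | r^n = s^2 = 1, s r s = r^-1\<rangle>\<close> of order \<open>2 n\<close> (for \<open>n > 0\<close>).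
  The pair \<open>(i, a)\<close> stands for the normal form \<open>r^i s^a\<close>, where \<open>i\<close> is a residue modulo \<open>n\<close>
  and \<open>a\<close> tells whether the reflection \<open>s\<close> occurs; \<open>s r^j = r^-j s\<close> gives the product.
\<close>

definition dihedral_group :: "nat \<Rightarrow> (int \<times> bool) monoid" where
  "dihedral_group n =
    \<lparr>carrier = {0..<int n} \<times> UNIV,
     mult = (\<lambda>(i, a) (j, b). ((if a then i - j else i + j) mod int n, a \<noteq> b)),
     one = (0, False)\<rparr>"

lemma group_dihedral_group:
  assumes "n > 0"
  shows "group (dihedral_group n)"
proof (rule groupI)
  fix x y z
  assume "x \<in> carrier (dihedral_group n)" "y \<in> carrier (dihedral_group n)"
    "z \<in> carrier (dihedral_group n)"
  then show "x \<otimes>\<^bsub>dihedral_group n\<^esub> y \<otimes>\<^bsub>dihedral_group n\<^esub> z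
      = x \<otimes>\<^bsub>dihedral_group n\<^esub> (y \<otimes>\<^bsub>dihedral_group n\<^esub> z)"
    by (cases x; cases y; cases z) (auto simp: dihedral_group_def mod_simps algebra_simps)
next
  fix x assume x: "x \<in> carrier (dihedral_group n)"
  obtain i a where [simp]: "x = (i, a)" by (cases x)
  let ?y = "(if a then i else (- i) mod int n, a)"
  have "?y \<in> carrier (dihedral_group n)"
    using x assms by (auto simp: dihedral_group_def)
  moreover have "?y \<otimes>\<^bsub>dihedral_group n\<^esub> x = \<one>\<^bsub>dihedral_group n\<^esub>"
    by (auto simp: dihedral_group_def mod_simps)
  ultimately show "\<exists>y\<in>carrier (dihedral_group n). y \<otimes>\<^bsub>dihedral_group n\<^esub> x = \<one>\<^bsub>dihedral_group n\<^esub>"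
    by blast
qed (use assms in \<open>auto simp: dihedral_group_def\<close>)

lemma order_dihedral_group: "Coset.order (dihedral_group n) = 2 * n"
  by (simp add: Coset.order_def dihedral_group_def card_cartesian_product)

lemma dihedral_group_relations:
  fixes n :: nat
  defines "r \<equiv> (1 mod int n, False)" and "s \<equiv> (0, True)"
  shows "r [^]\<^bsub>dihedral_group n\<^esub> k = (int k mod int n, False)"
    and "s \<otimes>\<^bsub>dihedral_group n\<^esub> s = \<one>\<^bsub>dihedral_group n\<^esub>"
    and "s \<otimes>\<^bsub>dihedral_group n\<^esub> r \<otimes>\<^bsub>dihedral_group n\<^esub> s \<otimes>\<^bsub>dihedral_group n\<^esub> r
      = \<one>\<^bsub>dihedral_group n\<^esub>"
proof -
  show "r [^]\<^bsub>dihedral_group n\<^esub> k = (int k mod int n, False)"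
    by (induction k) (auto simp: nat_pow_def dihedral_group_def r_def mod_simps algebra_simps)
qed (auto simp: dihedral_group_def r_def s_def mod_simps)

section \<open>Non-commuting graphs\<close>

definition group_center :: "('a, 'b) monoid_scheme \<Rightarrow> 'a set" where
  "group_center G = {z \<in> carrier G. \<forall>x \<in> carrier G. z \<otimes>\<^bsub>G\<^esub> x = x \<otimes>\<^bsub>G\<^esub> z}"

definition non_commuting_graph :: "('a, 'b) monoid_scheme \<Rightarrow> 'a pair_pre_digraph" where
  "non_commuting_graph G =
    \<lparr>pverts = carrier G - group_center G,
     parcs = {(x, y). x \<in> carrier G - group_center G \<and> y \<in> carrier G - group_center G \<and>
       x \<otimes>\<^bsub>G\<^esub> y \<noteq> y \<otimes>\<^bsub>G\<^esub> x}\<rparr>"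

lemma pair_graph_non_commuting_graph:
  assumes "finite (carrier G)"
  shows "pair_graph (non_commuting_graph G)"
proof -
  have "finite (parcs (non_commuting_graph G))"
    by (rule finite_subset[of _ "carrier G \<times> carrier G"])
      (use assms in \<open>auto simp: non_commuting_graph_def\<close>)
  then show ?thesis
    using assms
    by unfold_locales
      (auto simp: non_commuting_graph_def symmetric_def arcs_ends_def arc_to_ends_def
        with_proj_def sym_def image_iff)
qed

section \<open>Characteristic polynomial and spectrum of a finite graph\<close>

definition adjacency_mat :: "'v pair_pre_digraph \<Rightarrow> 'v list \<Rightarrow> 'a :: {zero, one} mat" where
  "adjacency_mat \<Gamma> vs =
    mat (length vs) (length vs) (\<lambda>(i, j). if (vs ! i, vs ! j) \<in> parcs \<Gamma> then 1 else 0)"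

definition vertex_enum :: "'v pair_pre_digraph \<Rightarrow> 'v list" where
  "vertex_enum \<Gamma> = (SOME vs. distinct vs \<and> set vs = pverts \<Gamma>)"

definition graph_char_poly :: "'v pair_pre_digraph \<Rightarrow> 'a :: comm_ring_1 poly" where
  "graph_char_poly \<Gamma> = char_poly (adjacency_mat \<Gamma> (vertex_enum \<Gamma>))"

text \<open>
  The multiplicity of an eigenvalue is the algebraic one, which for the adjacency matrix of an
  undirected graph agrees with the geometric one.
\<close>

definition mat_spectrum :: "'a :: field mat \<Rightarrow> 'a multiset" where
  "mat_spectrum A = (\<Sum>k\<in>spectrum A. replicate_mset (order k (char_poly A)) k)"

definition graph_spectrum :: "'v pair_pre_digraph \<Rightarrow> complex multiset" where
  "graph_spectrum \<Gamma> = mat_spectrum (adjacency_mat \<Gamma> (vertex_enum \<Gamma>))"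

text \<open>Neither notion depends on the chosen enumeration of the vertices.\<close>

lemma char_poly_adjacency_mat_unique:
  assumes "distinct vs" "distinct ws" "set vs = set ws"
  shows "(char_poly (adjacency_mat \<Gamma> ws) :: 'a :: comm_ring_1 poly)
    = char_poly (adjacency_mat \<Gamma> vs)"
proof -
  have "mset ws = mset vs"
    using assms by (simp add: set_eq_iff_mset_eq_distinct)
  then obtain p where p: "p permutes {..<length vs}" and ws: "permute_list p vs = ws"
    by (rule mset_eq_permutation)
  define n where "n = length vs"
  have p: "p permutes {0..<n}"
    using p by (simp add: n_def atLeast0LessThan)
  define C where "C = char_poly_matrix (adjacency_mat \<Gamma> vs :: 'a mat)"
  define D where "D = mat n n (\<lambda>(i, j). C $$ (p i, j))"
  have C: "C \<in> carrier_mat n n"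
    by (simp add: C_def adjacency_mat_def n_def)
  have D: "D \<in> carrier_mat n n"
    by (simp add: D_def)
  have len: "length ws = n"
    using ws by (auto simp: n_def)
  have pn: "p i < n" if "i < n" for i
    using permutes_in_image[OF p, of i] that by simp
  have inj: "p i = p j \<longleftrightarrow> i = j" for i j
    using permutes_inj[OF p] by (auto dest: injD)
  have wsn: "ws ! i = vs ! p i" if "i < n" for i
    using that p unfolding ws[symmetric] n_def
    by (intro permute_list_nth) (auto simp: atLeast0LessThan)
  have "char_poly_matrix (adjacency_mat \<Gamma> ws :: 'a mat)
      = (mat n n (\<lambda>(i, j). D\<^sup>T $$ (p i, j)))\<^sup>T"
    using pn by (intro eq_matI)
      (auto simp: C_def D_def char_poly_matrix_def adjacency_mat_def len wsn inj n_def[symmetric])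
  then have "char_poly (adjacency_mat \<Gamma> ws :: 'a mat)
      = det ((mat n n (\<lambda>(i, j). D\<^sup>T $$ (p i, j)))\<^sup>T)"
    by (simp add: char_poly_def)
  also have "\<dots> = det (mat n n (\<lambda>(i, j). D\<^sup>T $$ (p i, j)))"
    by (rule det_transpose[of _ n]) simp
  also have "\<dots> = signof p * det (D\<^sup>T)"
    by (rule det_permute_rows[OF _ p]) (use D in simp)
  also have "det (D\<^sup>T) = det D"
    by (rule det_transpose[OF D])
  also have "det D = signof p * det C"
    unfolding D_def by (rule det_permute_rows[OF C p])
  also have "signof p * (signof p * det C) = det C"
    by (simp add: sign_def)
  finally show ?thesis
    by (simp add: C_def char_poly_def)
qed

lemma vertex_enum:
  assumes "finite (pverts \<Gamma>)"
  shows "distinct (vertex_enum \<Gamma>)" "set (vertex_enum \<Gamma>) = pverts \<Gamma>"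
proof -
  have "\<exists>vs. distinct vs \<and> set vs = pverts \<Gamma>"
    using finite_distinct_list[OF assms] by blast
  from someI_ex[OF this] show "distinct (vertex_enum \<Gamma>)" "set (vertex_enum \<Gamma>) = pverts \<Gamma>"
    by (simp_all add: vertex_enum_def)
qed

lemma graph_char_poly_eq:
  assumes "distinct vs" "set vs = pverts \<Gamma>"
  shows "graph_char_poly \<Gamma> = char_poly (adjacency_mat \<Gamma> vs)"
proof -
  have "finite (pverts \<Gamma>)"
    using assms(2) by (metis List.finite_set)
  from vertex_enum[OF this] show ?thesis
    unfolding graph_char_poly_def
    by (intro char_poly_adjacency_mat_unique) (use assms in auto)
qed

lemma graph_spectrum_eq:
  assumes "distinct vs" "set vs = pverts \<Gamma>"
  shows "graph_spectrum \<Gamma> = mat_spectrum (adjacency_mat \<Gamma> vs)"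
proof -
  have *: "adjacency_mat \<Gamma> us \<in> carrier_mat (length us) (length us)" for us
    by (simp add: adjacency_mat_def)
  show ?thesis
    unfolding graph_spectrum_def mat_spectrum_def spectrum_root_char_poly[OF *]
    by (simp add: graph_char_poly_eq[OF assms, unfolded graph_char_poly_def])
qed

end

theory Submission
  imports Defs
begin

text \<open>
  Write \<open>n = 2 m\<close>. Two elements of \<open>G \<times> G\<close> commute iff their components do, so the adjacency matrix is
  \<open>J - C \<otimes> C\<close> (without the central elements), where \<open>C\<close> is the commutation matrix of \<open>G\<close> and \<open>J\<close> the
  all-ones matrix. If a matrix has constant column sums over the classes of a partition, its
  characteristic polynomial is that of the quotient times that of a complement spanned by differences
  inside the classes. First, collapsing the centraliser classes leaves only zero eigenvalues behind.
  Next, collapsing the \<open>m\<close> reflection classes of the first factor splits off \<open>m - 1\<close> copies of the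
  class quotient of \<open>- 2 C\<close>, each with characteristic polynomial \<open>- q\<close> times \<open>(x + 4)^(m-1)\<close>. Finally, collapsing those
  of the second factor splits off \<open>m - 1\<close> further copies of the quotient of \<open>- 2 C\<close>, with
  characteristic polynomial \<open>- q\<close>. What remains is an 8 by 8 quotient matrix, whose characteristic
  polynomial is \<open>f\<close>.
\<close>

section \<open>Determinants indexed by finite sets\<close>

text \<open>Entries depend on labels rather than positions, so that index sets can be split, mapped
  and reordered.\<close>

definition mat_on :: "'i list \<Rightarrow> ('i \<Rightarrow> 'i \<Rightarrow> 'a) \<Rightarrow> 'a mat" where
  "mat_on vs M = mat (length vs) (length vs) (\<lambda>(i, j). M (vs ! i) (vs ! j))"

lemma mat_on_carrier [simp]: "mat_on vs M \<in> carrier_mat (length vs) (length vs)"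
  by (simp add: mat_on_def)

lemma mat_on_cong:
  assumes "\<And>i j. i \<in> set vs \<Longrightarrow> j \<in> set vs \<Longrightarrow> M i j = N i j"
  shows "mat_on vs M = mat_on vs N"
  using assms by (intro eq_matI) (auto simp: mat_on_def)

text \<open>Two enumerations differ by a permutation acting on rows and columns alike, so its sign
  enters twice and cancels.\<close>

lemma det_mat_on_unique:
  fixes M :: "'i \<Rightarrow> 'i \<Rightarrow> 'a :: comm_ring_1"
  assumes "distinct vs" "distinct ws" "set vs = set ws"
  shows "det (mat_on ws M) = det (mat_on vs M)"
proof -
  have "mset ws = mset vs"
    using assms by (simp add: set_eq_iff_mset_eq_distinct)
  then obtain p where p: "p permutes {..<length vs}" and ws: "permute_list p vs = ws"
    by (rule mset_eq_permutation)
  define n where "n = length vs"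
  have p: "p permutes {0..<n}"
    using p by (simp add: n_def atLeast0LessThan)
  define C where "C = mat_on vs M"
  define D where "D = mat n n (\<lambda>(i, j). C $$ (p i, j))"
  have C: "C \<in> carrier_mat n n"
    by (simp add: C_def n_def)
  have D: "D \<in> carrier_mat n n"
    by (simp add: D_def)
  have len: "length ws = n"
    using ws by (auto simp: n_def)
  have pn: "p i < n" if "i < n" for i
    using permutes_in_image[OF p, of i] that by simp
  have wsn: "ws ! i = vs ! p i" if "i < n" for i
    using that p unfolding ws[symmetric] n_def
    by (intro permute_list_nth) (auto simp: atLeast0LessThan)
  have "mat_on ws M = (mat n n (\<lambda>(i, j). D\<^sup>T $$ (p i, j)))\<^sup>T"
    using pn by (intro eq_matI) (auto simp: C_def D_def mat_on_def len wsn n_def[symmetric])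
  then have "det (mat_on ws M) = det (mat n n (\<lambda>(i, j). D\<^sup>T $$ (p i, j)))"
    by (simp add: det_transpose[of _ n])
  also have "\<dots> = signof p * det D"
    using det_permute_rows[OF _ p, of "D\<^sup>T"] D by (simp add: det_transpose)
  also have "det D = signof p * det C"
    unfolding D_def by (rule det_permute_rows[OF C p])
  also have "signof p * (signof p * det C) = det C"
    by (simp add: sign_def)
  finally show ?thesis
    by (simp add: C_def)
qed

definition set_det :: "'i set \<Rightarrow> ('i \<Rightarrow> 'i \<Rightarrow> 'a :: comm_ring_1) \<Rightarrow> 'a" where
  "set_det I M = det (mat_on (SOME vs. distinct vs \<and> set vs = I) M)"

lemma set_det_eq:
  assumes "distinct vs" "set vs = I"
  shows "set_det I M = det (mat_on vs M)"
proof -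
  have "distinct (SOME vs. distinct vs \<and> set vs = I) \<and> set (SOME vs. distinct vs \<and> set vs = I) = I"
    by (rule someI[of _ vs]) (use assms in auto)
  then show ?thesis
    unfolding set_det_def using assms by (intro det_mat_on_unique) auto
qed

lemma set_det_cong:
  assumes "finite I" "\<And>i j. i \<in> I \<Longrightarrow> j \<in> I \<Longrightarrow> M i j = N i j"
  shows "set_det I M = set_det I N"
proof -
  obtain vs where vs: "distinct vs" "set vs = I"
    using finite_distinct_list[OF assms(1)] by blast
  then show ?thesis
    using mat_on_cong[of vs M N] assms(2) by (simp add: set_det_eq[OF vs])
qed

lemma set_det_empty [simp]: "set_det {} M = 1"
  by (subst set_det_eq[of "[]"]) (auto simp: mat_on_def)

lemma set_det_singleton [simp]: "set_det {i} M = M i i"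
  by (subst set_det_eq[of "[i]"]) (auto simp: det_single mat_on_def)

lemma set_det_mult:
  assumes "finite I"
  shows "set_det I (\<lambda>i j. \<Sum>k\<in>I. M i k * N k j) = set_det I M * set_det I N"
proof -
  obtain vs where vs: "distinct vs" "set vs = I"
    using finite_distinct_list[OF assms] by blast
  have "mat_on vs (\<lambda>i j. \<Sum>k\<in>I. M i k * N k j) = mat_on vs M * mat_on vs N"
    using vs(1) unfolding vs(2)[symmetric]
    by (intro eq_matI) (auto simp: mat_on_def scalar_prod_def set_conv_nth
        intro!: sum.reindex_bij_betw[symmetric] bij_betw_nth)
  then show ?thesis
    by (simp add: set_det_eq[OF vs] det_mult[OF mat_on_carrier mat_on_carrier])
qed

lemma set_det_reindex:
  assumes "finite I" "inj_on f I"
  shows "set_det (f ` I) M = set_det I (\<lambda>i j. M (f i) (f j))"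
proof -
  obtain vs where vs: "distinct vs" "set vs = I"
    using finite_distinct_list[OF assms(1)] by blast
  have "mat_on (map f vs) M = mat_on vs (\<lambda>i j. M (f i) (f j))"
    by (auto simp: mat_on_def)
  then show ?thesis
    using vs assms(2) by (simp add: set_det_eq[OF vs] set_det_eq[of "map f vs"] distinct_map)
qed

lemma set_det_Un:
  fixes M :: "'i \<Rightarrow> 'i \<Rightarrow> 'a :: idom"
  assumes "finite I" "finite J" "I \<inter> J = {}"
    and zero: "\<And>i j. i \<in> I \<Longrightarrow> j \<in> J \<Longrightarrow> M i j = 0"
  shows "set_det (I \<union> J) M = set_det I M * set_det J M"
proof -
  obtain vs where vs: "distinct vs" "set vs = I"
    using finite_distinct_list[OF assms(1)] by blast
  obtain ws where ws: "distinct ws" "set ws = J"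
    using finite_distinct_list[OF assms(2)] by blast
  let ?m = "length vs" and ?n = "length ws"
  have "mat_on (vs @ ws) M = four_block_mat (mat_on vs M) (0\<^sub>m ?m ?n)
      (mat ?n ?m (\<lambda>(i, j). M (ws ! i) (vs ! j))) (mat_on ws M)"
    using zero vs ws by (intro eq_matI) (auto simp: mat_on_def nth_append)
  then have "det (mat_on (vs @ ws) M) = det (mat_on vs M) * det (mat_on ws M)"
    by (simp add: det_four_block_mat_upper_right_zero[of _ ?m _ ?n])
  then show ?thesis
    using vs ws assms(3)
    by (simp add: set_det_eq[OF vs] set_det_eq[OF ws] set_det_eq[of "vs @ ws"])
qed

lemma set_det_diag:
  fixes M :: "'i \<Rightarrow> 'i \<Rightarrow> 'a :: idom"
  assumes "finite I" "\<And>i j. i \<in> I \<Longrightarrow> j \<in> I \<Longrightarrow> i \<noteq> j \<Longrightarrow> M i j = 0"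
  shows "set_det I M = (\<Prod>i\<in>I. M i i)"
  using assms
proof (induction I rule: finite_induct)
  case (insert a I)
  have "set_det ({a} \<union> I) M = set_det {a} M * set_det I M"
    by (rule set_det_Un) (use insert in auto)
  then show ?case
    using insert by simp
qed simp

lemma set_det_block:
  fixes M :: "'a \<times> 'i \<Rightarrow> 'a \<times> 'i \<Rightarrow> 'r :: idom"
  assumes "finite A" "finite I"
    and "\<And>a b i j. a \<in> A \<Longrightarrow> b \<in> A \<Longrightarrow> i \<in> I \<Longrightarrow> j \<in> I \<Longrightarrow> a \<noteq> b \<Longrightarrow> M (a, i) (b, j) = 0"
  shows "set_det (A \<times> I) M = (\<Prod>a\<in>A. set_det I (\<lambda>i j. M (a, i) (a, j)))"
  using assms(1,3)
proof (induction A rule: finite_induct)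
  case (insert a A)
  have "set_det ({a} \<times> I \<union> A \<times> I) M = set_det ({a} \<times> I) M * set_det (A \<times> I) M"
    by (rule set_det_Un) (use insert assms(2) in auto)
  also have "set_det ({a} \<times> I) M = set_det (Pair a ` I) M"
    by (rule arg_cong[where f = "\<lambda>J. set_det J M"]) auto
  also have "\<dots> = set_det I (\<lambda>i j. M (a, i) (a, j))"
    by (rule set_det_reindex) (use assms(2) in \<open>auto simp: inj_on_def\<close>)
  also have "{a} \<times> I \<union> A \<times> I = insert a A \<times> I"
    by auto
  finally show ?case
    using insert by simp
qed simp

text \<open>
  The fibres of \<open>\<kappa>\<close> form an equitable partition with transversal \<open>\<sigma>\<close>. Subtracting the column of the
  representative from every other column of its class, and then adding every row of a class to the
  row of its representative, makes the matrix block triangular.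
\<close>

lemma set_det_lump:
  fixes M :: "'i \<Rightarrow> 'i \<Rightarrow> 'a :: idom"
  assumes I: "finite I" and \<sigma>: "\<And>a. a \<in> L \<Longrightarrow> \<sigma> a \<in> I" "\<And>a. a \<in> L \<Longrightarrow> \<kappa> (\<sigma> a) = a"
    and \<kappa>: "\<And>x. x \<in> I \<Longrightarrow> \<kappa> x \<in> L"
    and lump: "\<And>a y. a \<in> L \<Longrightarrow> y \<in> I \<Longrightarrow>
      (\<Sum>x | x \<in> I \<and> \<kappa> x = a. M x y) = (\<Sum>x | x \<in> I \<and> \<kappa> x = a. M x (\<sigma> (\<kappa> y)))"
  shows "set_det I M = set_det L (\<lambda>a b. \<Sum>x | x \<in> I \<and> \<kappa> x = a. M x (\<sigma> b))
    * set_det (I - \<sigma> ` L) (\<lambda>x y. M x y - M x (\<sigma> (\<kappa> y)))"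
proof -
  define R where "R = \<sigma> ` L"
  define \<rho> where "\<rho> = (\<lambda>x. \<sigma> (\<kappa> x))"
  have inj: "inj_on \<sigma> L"
    using \<sigma>(2) by (rule inj_on_inverseI)
  have finL: "finite L"
    using finite_imageD[OF finite_subset[OF _ I] inj] \<sigma>(1) by blast
  have R: "R \<subseteq> I" "finite R"
    using \<sigma>(1) finL by (auto simp: R_def)
  have I_eq: "I = (I - R) \<union> R" "I = R \<union> (I - R)"
    using R by auto
  have \<rho>R: "\<rho> x \<in> R" if "x \<in> I" for x
    using \<kappa>[OF that] by (simp add: \<rho>_def R_def)
  have \<rho>_id: "\<rho> x = x" if "x \<in> R" for x
    using that \<sigma>(2) by (auto simp: R_def \<rho>_def)
  have \<rho>_eq: "\<rho> y = x \<longleftrightarrow> \<kappa> y = \<kappa> x" if "x \<in> R" "y \<in> I" for x y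
    using that \<sigma>(2) \<kappa> unfolding R_def \<rho>_def by (metis imageE)
  \<comment> \<open>On the right, \<open>E (- 1)\<close> subtracts from each non-representative
    column that of its representative; on the left, \<open>E 1\<close> adds to a representative row
    the other rows of its class. \<open>E c\<close> is block triangular with identity diagonal
    blocks.\<close>
  define E where "E c x y = (if x = y then 1 else 0) + (if y \<notin> R \<and> x = \<rho> y then c else 0)"
    for c :: 'a and x y
  have det_E: "set_det I (E c) = 1" for c
  proof -
    have "set_det I (E c) = set_det (I - R) (E c) * set_det R (E c)"
      by (subst I_eq(1), rule set_det_Un) (use I R in \<open>auto simp: E_def\<close>)
    also have "set_det (I - R) (E c) = (\<Prod>i\<in>I - R. E c i i)"
      using \<rho>R by (intro set_det_diag) (use I R in \<open>auto simp: E_def\<close>)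
    also have "\<dots> = 1"
      using \<rho>R by (intro prod.neutral) (force simp: E_def)
    also have "set_det R (E c) = (\<Prod>i\<in>R. E c i i)"
      by (intro set_det_diag) (use R in \<open>auto simp: E_def\<close>)
    also have "\<dots> = 1"
      by (intro prod.neutral) (simp add: E_def)
    finally show ?thesis by simp
  qed
  define N where "N x y = (if y \<in> R then M x y else M x y - M x (\<rho> y))" for x y
  define T where "T x y = (if x \<in> R then (\<Sum>z | z \<in> I \<and> \<kappa> z = \<kappa> x. N z y) else N x y)" for x y
  have "set_det I N = set_det I (\<lambda>x y. \<Sum>k\<in>I. M x k * E (- 1) k y)"
  proof (rule set_det_cong[OF I])
    fix x y assume "x \<in> I" "y \<in> I"
    then show "N x y = (\<Sum>k\<in>I. M x k * E (- 1) k y)"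
      using \<rho>R[of y] R I
      by (auto simp: N_def E_def distrib_left sum.distrib if_distrib[of "(*) _"] cong: if_cong)
  qed
  then have N: "set_det I N = set_det I M"
    by (simp add: set_det_mult[OF I] det_E)
  have "set_det I T = set_det I (\<lambda>x y. \<Sum>k\<in>I. E 1 x k * N k y)"
  proof (rule set_det_cong[OF I])
    fix x y assume xy: "x \<in> I" "y \<in> I"
    have "(\<Sum>k\<in>I. E 1 x k * N k y) = N x y + (\<Sum>k\<in>I. if k \<notin> R \<and> x = \<rho> k then N k y else 0)"
      using xy I by (simp add: E_def distrib_right sum.distrib if_distrib[of "\<lambda>u. u * _"] cong: if_cong)
    also have "(\<Sum>k\<in>I. if k \<notin> R \<and> x = \<rho> k then N k y else 0)
        = (\<Sum>k | k \<in> I \<and> k \<notin> R \<and> x = \<rho> k. N k y)"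
      using I by (simp add: sum.inter_filter)
    also have "N x y + \<dots> = T x y"
    proof (cases "x \<in> R")
      case True
      have "{z. z \<in> I \<and> \<kappa> z = \<kappa> x} = insert x {k. k \<in> I \<and> k \<notin> R \<and> x = \<rho> k}"
        using True \<rho>_eq \<rho>_id xy by (auto, metis+)
      then show ?thesis
        using True I by (simp add: T_def)
    next
      case False
      then have "{k. k \<in> I \<and> k \<notin> R \<and> x = \<rho> k} = {}"
        using \<rho>R by auto
      then show ?thesis
        using False by (simp only: T_def if_False sum.empty add_0_right)
    qed
    finally show "T x y = (\<Sum>k\<in>I. E 1 x k * N k y)" ..
  qed
  then have "set_det I T = set_det I M"
    by (simp add: set_det_mult[OF I] det_E N)
  moreover have "set_det I T = set_det R T * set_det (I - R) T"
  proof (subst I_eq(2), rule set_det_Un)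
    fix x y assume "x \<in> R" "y \<in> I - R"
    \<comment> \<open>Such an entry is the difference of two class column sums, which agree by
      \<open>lump\<close>.\<close>
    then show "T x y = 0"
      using lump[of "\<kappa> x" y] \<kappa> R by (auto simp: T_def N_def \<rho>_def sum_subtractf)
  qed (use I R in auto)
  moreover have "set_det R T = set_det L (\<lambda>a b. T (\<sigma> a) (\<sigma> b))"
    unfolding R_def by (rule set_det_reindex[OF finL inj])
  moreover have "\<dots> = set_det L (\<lambda>a b. \<Sum>x | x \<in> I \<and> \<kappa> x = a. M x (\<sigma> b))"
    by (rule set_det_cong[OF finL]) (auto simp: T_def N_def R_def \<sigma>(2))
  moreover have "set_det (I - R) T = set_det (I - R) (\<lambda>x y. M x y - M x (\<sigma> (\<kappa> y)))"
    by (rule set_det_cong) (use I in \<open>auto simp: T_def N_def \<rho>_def\<close>)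
  ultimately show ?thesis
    by (simp add: R_def)
qed

lemma sum_const_poly: "(\<Sum>x\<in>A. [:f x:]) = [:\<Sum>x\<in>A. f x:]"
  by (induction A rule: infinite_finite_induct) auto

section \<open>Characteristic polynomials and equitable partitions\<close>

definition char_poly_on :: "'i set \<Rightarrow> ('i \<Rightarrow> 'i \<Rightarrow> 'a :: comm_ring_1) \<Rightarrow> 'a poly" where
  "char_poly_on I B = set_det I (\<lambda>x y. (if x = y then [:0, 1:] else 0) - [:B x y:])"

lemma char_poly_on_eq:
  assumes "distinct vs" "set vs = I"
  shows "char_poly_on I B = char_poly (mat_on vs B)"
proof -
  have "mat_on vs (\<lambda>x y. (if x = y then [:0, 1:] else 0) - [:B x y:]) = char_poly_matrix (mat_on vs B)"
    using assms(1) by (intro eq_matI) (auto simp: mat_on_def char_poly_matrix_def nth_eq_iff_index_eq)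
  then show ?thesis
    by (simp add: char_poly_on_def set_det_eq[OF assms] char_poly_def)
qed

lemma degree_char_poly_on:
  assumes "finite I"
  shows "degree (char_poly_on I B) = card I"
proof -
  obtain vs where vs: "distinct vs" "set vs = I"
    using finite_distinct_list[OF assms] by blast
  then show ?thesis
    by (simp add: char_poly_on_eq[OF vs] degree_monic_char_poly[OF mat_on_carrier] flip: distinct_card)
qed

lemma char_poly_on_cong:
  assumes "finite I" "\<And>i j. i \<in> I \<Longrightarrow> j \<in> I \<Longrightarrow> B i j = C i j"
  shows "char_poly_on I B = char_poly_on I C"
  unfolding char_poly_on_def by (rule set_det_cong) (use assms in auto)

lemma char_poly_on_diag:
  fixes d :: "'i \<Rightarrow> 'a :: idom"
  assumes "finite I"
  shows "char_poly_on I (\<lambda>x y. if x = y then d x else 0) = (\<Prod>i\<in>I. [:- d i, 1:])"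
  unfolding char_poly_on_def by (subst set_det_diag) (use assms in auto)

lemma char_poly_on_block:
  fixes B :: "'i \<Rightarrow> 'i \<Rightarrow> 'a :: idom"
  assumes "finite A" "finite I"
  shows "char_poly_on (A \<times> I) (\<lambda>(a, i) (b, j). if a = b then B i j else 0) = char_poly_on I B ^ card A"
    (is "char_poly_on _ ?B = _")
proof -
  have "char_poly_on (A \<times> I) ?B = (\<Prod>a\<in>A. char_poly_on I B)"
    unfolding char_poly_on_def
    by (subst set_det_block) (use assms in \<open>auto intro!: prod.cong set_det_cong\<close>)
  then show ?thesis by simp
qed

lemma char_poly_on_block':
  fixes B :: "'i \<Rightarrow> 'i \<Rightarrow> 'a :: idom"
  assumes "finite A" "finite I"
  shows "char_poly_on (I \<times> A) (\<lambda>(i, a) (j, b). if a = b then B i j else 0) = char_poly_on I B ^ card A"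
proof -
  have "char_poly_on (prod.swap ` (A \<times> I)) (\<lambda>(i, a) (j, b). if a = b then B i j else 0)
      = char_poly_on (A \<times> I) (\<lambda>(a, i) (b, j). if a = b then B i j else 0)"
    unfolding char_poly_on_def
    by (subst set_det_reindex) (use assms in \<open>auto intro!: set_det_cong\<close>)
  then show ?thesis
    by (simp add: char_poly_on_block[OF assms] product_swap)
qed

text \<open>\<open>set_det_lump\<close> for X I - B. \<open>Q\<close> is the quotient matrix; the
  second factor is B on the invariant space of vectors with zero sum over every class, in the basis
  of differences between a non-representative and its representative.\<close>

lemma char_poly_on_lump:
  fixes B :: "'i \<Rightarrow> 'i \<Rightarrow> 'a :: idom"
  assumes I: "finite I" and \<sigma>: "\<And>a. a \<in> L \<Longrightarrow> \<sigma> a \<in> I" "\<And>a. a \<in> L \<Longrightarrow> \<kappa> (\<sigma> a) = a"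
    and \<kappa>: "\<And>x. x \<in> I \<Longrightarrow> \<kappa> x \<in> L"
    and lump: "\<And>a y. a \<in> L \<Longrightarrow> y \<in> I \<Longrightarrow> (\<Sum>x | x \<in> I \<and> \<kappa> x = a. B x y) = Q a (\<kappa> y)"
  shows "char_poly_on I B
    = char_poly_on L Q * char_poly_on (I - \<sigma> ` L) (\<lambda>x y. B x y - B x (\<sigma> (\<kappa> y)))"
proof -
  let ?M = "\<lambda>x y. (if x = y then [:0, 1:] else 0) - [:B x y:]"
  have sum: "(\<Sum>x | x \<in> I \<and> \<kappa> x = a. ?M x y) = (if a = \<kappa> y then [:0, 1:] else 0) - [:Q a (\<kappa> y):]"
    if "a \<in> L" "y \<in> I" for a y
  proof -
    have "(\<Sum>x | x \<in> I \<and> \<kappa> x = a. if x = y then [:0, 1:] else (0 :: 'a poly))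
        = (if a = \<kappa> y then [:0, 1:] else 0)"
      using I that by auto
    moreover have "(\<Sum>x | x \<in> I \<and> \<kappa> x = a. [:B x y:]) = [:Q a (\<kappa> y):]"
      unfolding lump[OF that, symmetric] by (rule sum_const_poly)
    ultimately show ?thesis
      by (simp add: sum_subtractf)
  qed
  have inj: "inj_on \<sigma> L"
    using \<sigma>(2) by (rule inj_on_inverseI)
  have finL: "finite L"
    using finite_imageD[OF finite_subset[OF _ I] inj] \<sigma>(1) by blast
  have "char_poly_on I B = set_det L (\<lambda>a b. \<Sum>x | x \<in> I \<and> \<kappa> x = a. ?M x (\<sigma> b))
    * set_det (I - \<sigma> ` L) (\<lambda>x y. ?M x y - ?M x (\<sigma> (\<kappa> y)))"
    unfolding char_poly_on_def
    by (rule set_det_lump[OF I \<sigma> \<kappa>]) (use sum \<sigma> \<kappa> in auto)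
  also have "set_det L (\<lambda>a b. \<Sum>x | x \<in> I \<and> \<kappa> x = a. ?M x (\<sigma> b)) = char_poly_on L Q"
    unfolding char_poly_on_def by (rule set_det_cong[OF finL]) (simp add: sum \<sigma>)
  also have "set_det (I - \<sigma> ` L) (\<lambda>x y. ?M x y - ?M x (\<sigma> (\<kappa> y)))
      = char_poly_on (I - \<sigma> ` L) (\<lambda>x y. B x y - B x (\<sigma> (\<kappa> y)))"
    unfolding char_poly_on_def
    \<comment> \<open>A remaining \<open>x\<close> is no representative, so the subtracted column
      carries no X in row \<open>x\<close>.\<close>
    by (rule set_det_cong) (use I \<kappa> in auto)
  finally show ?thesis .
qed

section \<open>Centraliser classes of the dihedral group\<close>

text \<open>
  In the dihedral group of order \<open>4 m\<close> the class 0 is the centre \<open>{1, r^m}\<close>, the class 1 consists of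
  the remaining rotations, and the class \<open>2 + j\<close> is \<open>{r^j s, r^(j+m) s}\<close> for \<open>j < m\<close>. Whether two
  elements commute depends only on their classes: this is the case \<open>linked k l = 1\<close>.
\<close>

definition dihedral_class :: "nat \<Rightarrow> int \<times> bool \<Rightarrow> nat" where
  "dihedral_class m = (\<lambda>(i, a). if a then 2 + nat (i mod int m) else if i mod int m = 0 then 0 else 1)"

definition class_rep :: "nat \<Rightarrow> int \<times> bool" where
  "class_rep k = (if k = 0 then (0, False) else if k = 1 then (1, False) else (int (k - 2), True))"

definition class_size :: "nat \<Rightarrow> nat \<Rightarrow> real" where
  "class_size m k = (if k = 1 then 2 * real m - 2 else 2)"

definition linked :: "nat \<Rightarrow> nat \<Rightarrow> real" where
  "linked k l = of_bool (k = 0 \<or> l = 0 \<or> k = l)"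

lemma class_rep:
  assumes "m \<ge> 3" "k < m + 2"
  shows "class_rep k \<in> carrier (dihedral_group (2 * m))" "dihedral_class m (class_rep k) = k"
  using assms by (auto simp: class_rep_def dihedral_group_def dihedral_class_def)

lemma dihedral_class_less:
  assumes "m \<ge> 3"
  shows "dihedral_class m x < m + 2"
proof -
  have "i mod int m < int m" for i
    using assms by simp
  then show ?thesis
    using assms by (auto simp: dihedral_class_def nat_less_iff split: prod.split)
qed

text \<open>The two lifts of a residue modulo m are the reason why the centre and every reflection
  class have two elements.\<close>

lemma mod_double_eq_iff:
  assumes "m > 0" "0 \<le> i" "i < 2 * int m" "0 \<le> j" "j < int m"
  shows "i mod int m = j \<longleftrightarrow> i = j \<or> i = j + int m"
proof (cases "i < int m")
  case False
  then have "i mod int m = (i - int m) mod int m"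
    by simp
  also have "\<dots> = i - int m"
    using False assms by (intro mod_pos_pos_trivial) auto
  finally show ?thesis
    using False assms by auto
qed (use assms in auto)

text \<open>Rotations commute with each other; r^j commutes with r^i s iff r^(2 j) = 1, and r^i s
  with r^j s iff r^(2 (i - j)) = 1. Cancelling 2 turns congruences modulo 2 m into congruences
  modulo m.\<close>

lemma dihedral_commute_iff:
  assumes "m \<ge> 3"
  shows "x \<otimes>\<^bsub>dihedral_group (2 * m)\<^esub> y = y \<otimes>\<^bsub>dihedral_group (2 * m)\<^esub> x
    \<longleftrightarrow> linked (dihedral_class m x) (dihedral_class m y) = 1"
proof -
  have double: "2 * int m dvd 2 * k \<longleftrightarrow> int m dvd k" for k
    by simp
  have a: "(i - j) mod (2 * int m) = (j + i) mod (2 * int m) \<longleftrightarrow> int m dvd j" for i j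
    using double[of "- j"] by (simp add: mod_eq_dvd_iff)
  have b: "(i - j) mod (2 * int m) = (j - i) mod (2 * int m) \<longleftrightarrow> i mod int m = j mod int m" for i j
    using double[of "i - j"] by (simp add: mod_eq_dvd_iff)
  have c: "nat (i mod int m) = nat (j mod int m) \<longleftrightarrow> i mod int m = j mod int m" for i j
    using assms by (simp add: eq_nat_nat_iff)
  have a': "(j + i) mod (2 * int m) = (i - j) mod (2 * int m) \<longleftrightarrow> int m dvd j" for i j
    using a[of i j] by auto
  have d: "(i + j) mod (2 * int m) = (j + i) mod (2 * int m) \<longleftrightarrow> True" for i j
    by (simp add: add.commute)
  obtain i s j t where [simp]: "x = (i, s)" "y = (j, t)"
    by (cases x; cases y)
  show ?thesis
    by (cases s; cases t)
      (simp_all add: dihedral_group_def dihedral_class_def linked_def a a' b c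
        mod_eq_0_iff_dvd d)
qed

lemma card_dihedral_class:
  assumes "m \<ge> 3" "k < m + 2"
  shows "real (card {x \<in> carrier (dihedral_group (2 * m)). dihedral_class m x = k}) = class_size m k"
    (is "real (card ?F) = _")
proof -
  consider "k = 0" | "k = 1" | j where "k = 2 + j" "j < m"
  proof -
    have "k = 0 \<or> k = 1 \<or> (k = 2 + (k - 2) \<and> k - 2 < m)"
      using assms by linarith
    then show ?thesis
      using that by blast
  qed
  then show ?thesis
  proof cases
    case 1
    have "?F = {(0, False), (int m, False)}"
      using 1 assms mod_double_eq_iff[of m _ 0]
      by (auto simp: dihedral_group_def dihedral_class_def split: if_splits)
    then show ?thesis
      using 1 assms by (simp add: class_size_def)
  next
    case 2
    have "?F = ({0..<2 * int m} - {0, int m}) \<times> {False}"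
      using 2 assms mod_double_eq_iff[of m _ 0]
      by (auto simp: dihedral_group_def dihedral_class_def split: if_splits)
    then have "card ?F = card ({0..<2 * int m} - {0, int m})"
      by (simp add: card_cartesian_product)
    also have "\<dots> = 2 * m - 2"
      using assms by (subst card_Diff_subset) auto
    finally show ?thesis
      using 2 assms by (simp add: class_size_def of_nat_diff)
  next
    case 3
    have "?F = {(int j, True), (int j + int m, True)}"
      using 3 assms mod_double_eq_iff[of m _ "int j"]
      by (auto simp: dihedral_group_def dihedral_class_def nat_eq_iff split: if_splits)
    then show ?thesis
      using 3 assms by (simp add: class_size_def)
  qed
qed

section \<open>Two-step reduction to types of classes\<close>

definition class_labels :: "nat \<Rightarrow> nat set" where
  "class_labels m = {..<m + 2}"

text \<open>The class quotient of the adjacency matrix: the entry counts the elements of class pair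
  (a, b) that do not commute with a fixed element of class pair (c, d).\<close>

definition class_pair_mat :: "nat \<Rightarrow> nat \<times> nat \<Rightarrow> nat \<times> nat \<Rightarrow> real" where
  "class_pair_mat m = (\<lambda>(a, b) (c, d). class_size m a * class_size m b * (1 - linked a c * linked b d))"

text \<open>
  The \<open>m\<close> reflection classes are merged into a single type 2, so that \<open>min k 2\<close> is the type of the
  class \<open>k\<close>. The entry \<open>(a, b)\<close> counts the elements of type \<open>a\<close> commuting with a fixed element of
  type \<open>b\<close>; as everything commutes with the centre, column 0 contains the sizes of the types.
\<close>

definition type_mat :: "nat \<Rightarrow> nat \<Rightarrow> nat \<Rightarrow> real" where
  "type_mat m a b = (if a = 0 then 2 else if a = 1 then (if b = 2 then 0 else 2 * real m - 2)
     else if b = 0 then 2 * real m else if b = 1 then 0 else 2)"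

text \<open>Merging classes into types is equitable: a reflection class is linked to no other
  reflection class, so the sum does not depend on which one \<open>c\<close> is.\<close>

lemma sum_linked:
  assumes "a < 3" "c < m + 2"
  shows "(\<Sum>k | k < m + 2 \<and> min k 2 = a. class_size m k * linked k c) = type_mat m a (min c 2)"
proof -
  consider "a = 0" | "a = 1" | "a = 2"
    using assms by linarith
  then show ?thesis
  proof cases
    case 1
    then have "{k. k < m + 2 \<and> min k 2 = a} = {0}"
      by auto
    then show ?thesis
      using 1 by (simp add: class_size_def linked_def type_mat_def)
  next
    case 2
    then have "{k. k < m + 2 \<and> min k 2 = a} = {1}"
      by auto
    then show ?thesis
      using 2 by (auto simp: class_size_def linked_def type_mat_def min_def)
  next
    case 3
    then have "{k. k < m + 2 \<and> min k 2 = a} = {2..<m + 2}"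
      by auto
    then have "(\<Sum>k | k < m + 2 \<and> min k 2 = a. class_size m k * linked k c)
        = (\<Sum>k\<in>{2..<m + 2}. if c = 0 then 2 else if k = c then 2 else 0)"
      by (auto simp: class_size_def linked_def intro!: sum.cong)
    also have "\<dots> = type_mat m a (min c 2)"
      using 3 assms by (cases "c = 0") (auto simp: type_mat_def)
    finally show ?thesis .
  qed
qed

lemma sum_class_size:
  assumes "a < 3"
  shows "(\<Sum>k | k < m + 2 \<and> min k 2 = a. class_size m k) = type_mat m a 0"
  using sum_linked[OF assms, of 0 m] by (simp add: linked_def)

text \<open>The monic polynomial - q of the theorem for n = 2 m.\<close>

definition cubic :: "nat \<Rightarrow> real poly" where
  "cubic m = [:- (64 * real m * (real m - 1)), 0, 4 * real m + 4, 1:]"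

text \<open>The factor - 2 arises when columns of two reflection classes are subtracted: J cancels,
  and the class size 2 remains with the sign of - C \<otimes> C.\<close>

lemma char_poly_on_type_mat:
  "char_poly_on {..<3 :: nat} (\<lambda>a b. - 2 * type_mat m a b) = cubic m"
proof -
  have vs: "distinct [0, 1, 2 :: nat]" "set [0, 1, 2 :: nat] = {..<3}"
    by auto
  have car: "mat_on [0, 1, 2] M \<in> carrier_mat 3 3" for M :: "nat \<Rightarrow> nat \<Rightarrow> real poly"
    by (simp add: mat_on_def numeral_3_eq_3)
  have S: "{0..<3} = {0, 1, 2 :: nat}"
    by auto
  have f: "finite {1, 2 :: nat}" "0 \<notin> {1, 2 :: nat}" "finite {2 :: nat}" "1 \<notin> {2 :: nat}"
    by auto
  show ?thesis
    \<comment> \<open>Leibniz expansion; the six permutations of {0, 1, 2} are generated by peeling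
      off 0 and then 1.\<close>
    unfolding char_poly_on_def set_det_eq[OF vs] det_def'[OF car] S
      sum_over_permutations_insert[OF f(1,2)] sum_over_permutations_insert[OF f(3,4)]
    by (simp add: mat_on_def sign_swap_id permutes_sing sign_compose permutation_swap_id type_mat_def
        sign_id swap_id_eq cubic_def algebra_simps)
qed

text \<open>The quotient by types gives the cubic. Differences of reflection classes span m - 1
  dimensions on which the matrix is the scalar - 4 = - 2 * 2.\<close>

lemma char_poly_on_linked:
  assumes "m \<ge> 3"
  shows "char_poly_on (class_labels m) (\<lambda>b d. - 2 * class_size m b * linked b d)
    = cubic m * [:4, 1:] ^ (m - 1)"
proof -
  let ?B = "\<lambda>b d. - 2 * class_size m b * linked b d"
  \<comment> \<open>The labels 0, 1, 2 represent the types, so the transversal is the identity and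
    class 2 stands for all reflections.\<close>
  have "char_poly_on (class_labels m) ?B = char_poly_on {..<3 :: nat} (\<lambda>a b. - 2 * type_mat m a b)
    * char_poly_on (class_labels m - (\<lambda>k. k) ` {..<3 :: nat}) (\<lambda>x y. ?B x y - ?B x (min y 2))"
  proof (rule char_poly_on_lump)
    fix a y assume "a \<in> {..<3 :: nat}" "y \<in> class_labels m"
    then have "(\<Sum>k | k < m + 2 \<and> min k 2 = a. class_size m k * linked k y) = type_mat m a (min y 2)"
      by (intro sum_linked) (auto simp: class_labels_def)
    moreover have "(\<Sum>x | x \<in> class_labels m \<and> min x 2 = a. ?B x y)
        = - 2 * (\<Sum>k | k < m + 2 \<and> min k 2 = a. class_size m k * linked k y)"
      by (simp add: class_labels_def sum_distrib_left mult.assoc)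
    ultimately show "(\<Sum>x | x \<in> class_labels m \<and> min x 2 = a. ?B x y) = - 2 * type_mat m a (min y 2)"
      by simp
  qed (use assms in \<open>auto simp: class_labels_def\<close>)
  also have "class_labels m - (\<lambda>k. k) ` {..<3 :: nat} = {3..<m + 2}"
    by (auto simp: class_labels_def)
  also have "char_poly_on {3..<m + 2} (\<lambda>x y. ?B x y - ?B x (min y 2))
      = char_poly_on {3..<m + 2} (\<lambda>x y. if x = y then - 4 else 0)"
    by (rule char_poly_on_cong) (auto simp: class_size_def linked_def)
  also have "\<dots> = [:4, 1:] ^ (m - 1)"
    by (subst char_poly_on_diag) (auto simp: Suc_diff_Suc numeral_eq_Suc)
  finally show ?thesis
    by (simp only: char_poly_on_type_mat)
qed

text \<open>The pair (0, 0) is the centre of G \<times> G, which is not in the graph; eight pairs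
  remain, whence the degree of f.\<close>

definition type_pairs :: "(nat \<times> nat) set" where
  "type_pairs = {..<3 :: nat} \<times> {..<3 :: nat} - {(0, 0)}"

text \<open>The quotient of J - C \<otimes> C by pairs of types; the first product is the size of a
  type pair.\<close>

definition type_pair_mat :: "nat \<Rightarrow> nat \<times> nat \<Rightarrow> nat \<times> nat \<Rightarrow> real" where
  "type_pair_mat m = (\<lambda>(a, b) (c, d). type_mat m a 0 * type_mat m b 0 - type_mat m a c * type_mat m b d)"

text \<open>Rows and columns are indexed by a type in the first factor and a class in the second.\<close>

definition mixed_mat :: "nat \<Rightarrow> nat \<times> nat \<Rightarrow> nat \<times> nat \<Rightarrow> real" where
  "mixed_mat m = (\<lambda>(a, b) (c, d). class_size m b * (type_mat m a 0 - type_mat m a c * linked b d))"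

text \<open>Differences against reflection class 2 of the second factor kill J and decouple the m -
  1 classes above it, leaving for each a copy of - 2 \<open>type_mat\<close> in the first
  factor.\<close>

lemma char_poly_on_mixed_mat:
  assumes "m \<ge> 3"
  shows "char_poly_on ({..<3 :: nat} \<times> class_labels m - {(0, 0)}) (mixed_mat m)
    = char_poly_on type_pairs (type_pair_mat m) * cubic m ^ (m - 1)"
proof -
  let ?I = "{..<3 :: nat} \<times> class_labels m - {(0, 0)}"
  let ?\<kappa> = "(\<lambda>(a, b). (a, min b 2)) :: nat \<times> nat \<Rightarrow> nat \<times> nat"
  let ?B = "mixed_mat m"
  have card: "card {3..<m + 2} = m - 1"
    by simp
  have "char_poly_on ?I ?B = char_poly_on type_pairs (type_pair_mat m)
    * char_poly_on (?I - (\<lambda>k. k) ` type_pairs) (\<lambda>x y. ?B x y - ?B x (?\<kappa> y))"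
  proof (rule char_poly_on_lump)
    fix p y assume p: "p \<in> type_pairs" and y: "y \<in> ?I"
    obtain a b c d where [simp]: "p = (a, b)" "y = (c, d)"
      by (cases p; cases y)
    have ab: "a < 3" "b < 3" "(a, b) \<noteq> (0, 0)" and cd: "d < m + 2"
      using p y by (auto simp: type_pairs_def class_labels_def)
    have "{x. x \<in> ?I \<and> ?\<kappa> x = p} = {a} \<times> {k. k < m + 2 \<and> min k 2 = b}"
      using ab by (auto simp: class_labels_def)
    then have "(\<Sum>x | x \<in> ?I \<and> ?\<kappa> x = p. ?B x y)
        = (\<Sum>k | k < m + 2 \<and> min k 2 = b. ?B (a, k) y)"
      by (simp add: sum.cartesian_product')
    also have "\<dots> = (\<Sum>k | k < m + 2 \<and> min k 2 = b. class_size m k) * type_mat m a 0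
        - (\<Sum>k | k < m + 2 \<and> min k 2 = b. class_size m k * linked k d) * type_mat m a c"
      unfolding sum_distrib_right sum_subtractf[symmetric]
      by (intro sum.cong) (auto simp: mixed_mat_def algebra_simps)
    also have "\<dots> = type_pair_mat m p (?\<kappa> y)"
      using ab cd by (simp only: sum_linked sum_class_size) (simp add: type_pair_mat_def)
    finally show "(\<Sum>x | x \<in> ?I \<and> ?\<kappa> x = p. ?B x y) = type_pair_mat m p (?\<kappa> y)" .
  qed (use assms in \<open>auto simp: class_labels_def type_pairs_def\<close>)
  \<comment> \<open>(0, 0) is missing from the index set and from the representatives alike, so the
    remainder is a full product.\<close>
  also have "?I - (\<lambda>k. k) ` type_pairs = {..<3 :: nat} \<times> {3..<m + 2}"
    by (auto simp: class_labels_def type_pairs_def)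
  also have "char_poly_on ({..<3 :: nat} \<times> {3..<m + 2}) (\<lambda>x y. ?B x y - ?B x (?\<kappa> y))
      = char_poly_on ({..<3 :: nat} \<times> {3..<m + 2})
          (\<lambda>(a, b) (c, d). if b = d then - 2 * type_mat m a c else 0)"
    by (rule char_poly_on_cong) (auto simp: mixed_mat_def class_size_def linked_def)
  also have "\<dots> = cubic m ^ (m - 1)"
    by (subst char_poly_on_block') (simp_all only: char_poly_on_type_mat card finite_lessThan finite_atLeastLessThan)
  finally show ?thesis .
qed

text \<open>The same elimination in the first factor; here each of the m - 1 decoupled blocks is the
  whole class quotient of - 2 C on the second factor.\<close>

lemma char_poly_on_class_pair_mat:
  assumes "m \<ge> 3"
  shows "char_poly_on (class_labels m \<times> class_labels m - {(0, 0)}) (class_pair_mat m)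
    = char_poly_on ({..<3 :: nat} \<times> class_labels m - {(0, 0)}) (mixed_mat m)
      * (cubic m * [:4, 1:] ^ (m - 1)) ^ (m - 1)"
proof -
  let ?I = "class_labels m \<times> class_labels m - {(0, 0)}" and ?L = "{..<3 :: nat} \<times> class_labels m - {(0, 0)}"
  let ?\<kappa> = "(\<lambda>(a, b). (min a 2, b)) :: nat \<times> nat \<Rightarrow> nat \<times> nat"
  let ?B = "class_pair_mat m"
  have card: "card {3..<m + 2} = m - 1"
    by simp
  have "char_poly_on ?I ?B = char_poly_on ?L (mixed_mat m)
    * char_poly_on (?I - (\<lambda>k. k) ` ?L) (\<lambda>x y. ?B x y - ?B x (?\<kappa> y))"
  proof (rule char_poly_on_lump)
    fix p y assume p: "p \<in> ?L" and y: "y \<in> ?I"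
    obtain a b c d where [simp]: "p = (a, b)" "y = (c, d)"
      by (cases p; cases y)
    have ab: "a < 3" "b < m + 2" "(a, b) \<noteq> (0, 0)" and cd: "c < m + 2"
      using p y by (auto simp: class_labels_def)
    have "{x. x \<in> ?I \<and> ?\<kappa> x = p} = {k. k < m + 2 \<and> min k 2 = a} \<times> {b}"
      using ab by (auto simp: class_labels_def)
    then have "(\<Sum>x | x \<in> ?I \<and> ?\<kappa> x = p. ?B x y)
        = (\<Sum>k | k < m + 2 \<and> min k 2 = a. ?B (k, b) y)"
      by (simp add: sum.cartesian_product')
    also have "\<dots> = (\<Sum>k | k < m + 2 \<and> min k 2 = a. class_size m k) * class_size m b
        - (\<Sum>k | k < m + 2 \<and> min k 2 = a. class_size m k * linked k c) * (class_size m b * linked b d)"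
      unfolding sum_distrib_right sum_subtractf[symmetric]
      by (intro sum.cong) (auto simp: class_pair_mat_def algebra_simps)
    also have "\<dots> = mixed_mat m p (?\<kappa> y)"
      using ab cd by (simp only: sum_linked sum_class_size) (simp add: mixed_mat_def algebra_simps)
    finally show "(\<Sum>x | x \<in> ?I \<and> ?\<kappa> x = p. ?B x y) = mixed_mat m p (?\<kappa> y)" .
  qed (use assms in \<open>auto simp: class_labels_def\<close>)
  also have "?I - (\<lambda>k. k) ` ?L = {3..<m + 2} \<times> class_labels m"
    by (auto simp: class_labels_def)
  also have "char_poly_on ({3..<m + 2} \<times> class_labels m) (\<lambda>x y. ?B x y - ?B x (?\<kappa> y))
      = char_poly_on ({3..<m + 2} \<times> class_labels m)
          (\<lambda>(a, b) (c, d). if a = c then - 2 * class_size m b * linked b d else 0)"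
    by (rule char_poly_on_cong) (auto simp: class_pair_mat_def class_size_def linked_def class_labels_def)
  also have "\<dots> = (cubic m * [:4, 1:] ^ (m - 1)) ^ (m - 1)"
    by (subst char_poly_on_block)
      (simp_all only: char_poly_on_linked[OF assms, unfolded class_labels_def] card class_labels_def finite_lessThan finite_atLeastLessThan)
  finally show ?thesis .
qed

section \<open>The non-commuting graph of the square\<close>

lemma graph_char_poly_eq_char_poly_on:
  assumes "finite (pverts \<Gamma>)"
  shows "graph_char_poly \<Gamma> = char_poly_on (pverts \<Gamma>) (\<lambda>x y. if (x, y) \<in> parcs \<Gamma> then 1 else 0)"
proof -
  obtain vs where vs: "distinct vs" "set vs = pverts \<Gamma>"
    using finite_distinct_list[OF assms] by blast
  show ?thesis
    unfolding graph_char_poly_eq[OF vs] char_poly_on_eq[OF vs]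
    by (simp add: adjacency_mat_def mat_on_def)
qed

text \<open>The complex adjacency matrix is the image of the real one and multiplicities are root
  orders, so a real factorisation determines the spectrum.\<close>

lemma graph_spectrum_eq_proots:
  "graph_spectrum \<Gamma> = proots (map_poly complex_of_real (graph_char_poly \<Gamma>))"
proof -
  let ?vs = "vertex_enum \<Gamma>"
  let ?A = "adjacency_mat \<Gamma> ?vs :: complex mat"
  have A: "adjacency_mat \<Gamma> ?vs \<in> carrier_mat (length ?vs) (length ?vs)"
    by (simp add: adjacency_mat_def)
  have "?A = map_mat complex_of_real (adjacency_mat \<Gamma> ?vs)"
    by (intro eq_matI) (auto simp: adjacency_mat_def)
  then have cp: "char_poly ?A = map_poly complex_of_real (graph_char_poly \<Gamma>)"
    by (simp add: of_real_hom.char_poly_hom[OF A] graph_char_poly_def)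
  have nz: "char_poly ?A \<noteq> 0"
    using degree_monic_char_poly[OF A, where ?'a = complex] by (metis coeff_0 zero_neq_one)
  have "graph_spectrum \<Gamma> = (\<Sum>k\<in>set_mset (proots (char_poly ?A)). replicate_mset (count (proots (char_poly ?A)) k) k)"
    using nz by (simp add: graph_spectrum_def mat_spectrum_def spectrum_root_char_poly[OF A])
  also have "\<dots> = proots (char_poly ?A)"
    by (intro multiset_eqI) (simp add: count_sum not_in_iff)
  finally show ?thesis
    by (simp add: cp)
qed

lemma group_center_dihedral_square:
  assumes "m \<ge> 3"
  shows "group_center (dihedral_group (2 * m) \<times>\<times> dihedral_group (2 * m))
    = {x \<in> carrier (dihedral_group (2 * m) \<times>\<times> dihedral_group (2 * m)).
        dihedral_class m (fst x) = 0 \<and> dihedral_class m (snd x) = 0}"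
proof -
  let ?D = "dihedral_group (2 * m)"
  have central: "(\<forall>y\<in>carrier ?D. x \<otimes>\<^bsub>?D\<^esub> y = y \<otimes>\<^bsub>?D\<^esub> x) \<longleftrightarrow> dihedral_class m x = 0" for x
  proof
    assume *: "\<forall>y\<in>carrier ?D. x \<otimes>\<^bsub>?D\<^esub> y = y \<otimes>\<^bsub>?D\<^esub> x"
    have "linked (dihedral_class m x) k = 1" if "k < m + 2" for k
      using * class_rep[OF assms that] dihedral_commute_iff[OF assms] by metis
    \<comment> \<open>Only class 0 is linked to both class 1 and class 2.\<close>
    from this[of 1] this[of 2] show "dihedral_class m x = 0"
      using assms by (auto simp: linked_def of_bool_def split: if_splits)
  qed (simp add: dihedral_commute_iff[OF assms] linked_def)
  \<comment> \<open>With a nonempty carrier the condition on pairs splits into one for each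
    component.\<close>
  have "carrier ?D \<noteq> {}"
    using class_rep(1)[OF assms, of 0] by auto
  then show ?thesis
    unfolding group_center_def central[symmetric] by (auto simp: DirProd_def)
qed

lemma card_dihedral_square:
  "card (carrier (dihedral_group n \<times>\<times> dihedral_group n)) = 4 * n ^ 2"
  using order_dihedral_group[of n]
  by (simp add: DirProd_def card_cartesian_product Coset.order_def power2_eq_square)

text \<open>Vertices of the same class pair have equal adjacency columns, so the column differences
  vanish and the complement contributes only a power of X.\<close>

lemma graph_char_poly_dihedral_square:
  assumes "m \<ge> 3"
  shows "graph_char_poly (non_commuting_graph (dihedral_group (2 * m) \<times>\<times> dihedral_group (2 * m)))
    = char_poly_on (class_labels m \<times> class_labels m - {(0, 0)}) (class_pair_mat m)
      * [:0, 1:] ^ (15 * m ^ 2 - 4 * m - 7)"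
proof -
  let ?D = "dihedral_group (2 * m)" and ?\<Gamma> = "non_commuting_graph (dihedral_group (2 * m) \<times>\<times> dihedral_group (2 * m))"
  let ?\<kappa> = "map_prod (dihedral_class m) (dihedral_class m)" and ?\<sigma> = "map_prod class_rep class_rep"
  let ?L = "class_labels m \<times> class_labels m - {(0, 0)}"
  let ?B = "\<lambda>x y. if (x, y) \<in> parcs ?\<Gamma> then 1 else 0 :: real"
  define I where "I = pverts ?\<Gamma>"
  have I: "I = {x \<in> carrier ?D \<times> carrier ?D. ?\<kappa> x \<noteq> (0, 0)}"
    unfolding I_def non_commuting_graph_def group_center_dihedral_square[OF assms]
    by (auto simp: DirProd_def)
  have fin: "finite I"
    unfolding I by (rule finite_subset[of _ "carrier ?D \<times> carrier ?D"]) (auto simp: dihedral_group_def)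
  have \<sigma>: "?\<sigma> a \<in> I" "?\<kappa> (?\<sigma> a) = a" if "a \<in> ?L" for a
    using that class_rep[OF assms] by (auto simp: I class_labels_def)
  have B: "?B x y = 1 - linked (fst (?\<kappa> x)) (fst (?\<kappa> y)) * linked (snd (?\<kappa> x)) (snd (?\<kappa> y))"
    if "x \<in> I" "y \<in> I" for x y
  proof -
    have "(x, y) \<in> parcs ?\<Gamma> \<longleftrightarrow> \<not> (linked (fst (?\<kappa> x)) (fst (?\<kappa> y)) = 1 \<and> linked (snd (?\<kappa> x)) (snd (?\<kappa> y)) = 1)"
      using that by (auto simp: I_def non_commuting_graph_def DirProd_def dihedral_commute_iff[OF assms])
    then show ?thesis
      by (auto simp: linked_def)
  qed
  have fib: "real (card {x. x \<in> I \<and> ?\<kappa> x = a}) = class_size m (fst a) * class_size m (snd a)"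
    if "a \<in> ?L" for a
  proof -
    have "{x. x \<in> I \<and> ?\<kappa> x = a} = {x \<in> carrier ?D. dihedral_class m x = fst a}
        \<times> {x \<in> carrier ?D. dihedral_class m x = snd a}"
      using that by (auto simp: I)
    then show ?thesis
      using that by (auto simp: card_cartesian_product card_dihedral_class[OF assms] class_labels_def)
  qed
  have "char_poly_on I ?B = char_poly_on ?L (class_pair_mat m)
    * char_poly_on (I - ?\<sigma> ` ?L) (\<lambda>x y. ?B x y - ?B x (?\<sigma> (?\<kappa> y)))"
  proof (rule char_poly_on_lump[OF fin \<sigma>])
    show \<kappa>: "?\<kappa> x \<in> ?L" if "x \<in> I" for x
      using that dihedral_class_less[OF assms] by (auto simp: I class_labels_def)
    fix a y assume a: "a \<in> ?L" and y: "y \<in> I"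
    have "(\<Sum>x | x \<in> I \<and> ?\<kappa> x = a. ?B x y)
        = (\<Sum>x | x \<in> I \<and> ?\<kappa> x = a. 1 - linked (fst a) (fst (?\<kappa> y)) * linked (snd a) (snd (?\<kappa> y)))"
      by (rule sum.cong) (use B y in auto)
    also have "\<dots> = class_pair_mat m a (?\<kappa> y)"
      using fib[OF a] by (simp add: class_pair_mat_def case_prod_beta)
    finally show "(\<Sum>x | x \<in> I \<and> ?\<kappa> x = a. ?B x y) = class_pair_mat m a (?\<kappa> y)" .
  qed
  \<comment> \<open>The \<open>if\<close> with equal branches gives the zero matrix the diagonal
    shape that \<open>char_poly_on_diag\<close> expects.\<close>
  also have "char_poly_on (I - ?\<sigma> ` ?L) (\<lambda>x y. ?B x y - ?B x (?\<sigma> (?\<kappa> y)))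
      = char_poly_on (I - ?\<sigma> ` ?L) (\<lambda>x y. if x = y then 0 else 0)"
  proof (rule char_poly_on_cong)
    fix x y assume "x \<in> I - ?\<sigma> ` ?L" "y \<in> I - ?\<sigma> ` ?L"
    then have xy: "x \<in> I" "y \<in> I"
      by auto
    have "?\<kappa> y \<in> ?L"
      using xy dihedral_class_less[OF assms] by (auto simp: I class_labels_def)
    note z = \<sigma>[OF this]
    show "?B x y - ?B x (?\<sigma> (?\<kappa> y)) = (if x = y then 0 else 0)"
      unfolding B[OF xy] B[OF xy(1) z(1)] z(2) by simp
  qed (use fin in simp)
  also have "\<dots> = [:0, 1:] ^ card (I - ?\<sigma> ` ?L)"
    by (subst char_poly_on_diag) (use fin in auto)
  \<comment> \<open>There are 16 m^2 - 4 vertices, four elements being central, and (m + 2)^2 - 1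
    representatives.\<close>
  also have "card (I - ?\<sigma> ` ?L) = 15 * m ^ 2 - 4 * m - 7"
  proof -
    have "carrier (?D \<times>\<times> ?D) - I = {x \<in> carrier ?D. dihedral_class m x = 0} \<times> {x \<in> carrier ?D. dihedral_class m x = 0}"
      by (auto simp: I DirProd_def)
    moreover have "card {x \<in> carrier ?D. dihedral_class m x = 0} = 2"
      using card_dihedral_class[OF assms, of 0] by (simp add: class_size_def)
    moreover have "I \<subseteq> carrier (?D \<times>\<times> ?D)"
      by (auto simp: I DirProd_def)
    moreover have "finite (carrier (?D \<times>\<times> ?D))"
      by (simp add: DirProd_def dihedral_group_def)
    ultimately have "card I = 16 * m ^ 2 - 4"
      using card_dihedral_square[of "2 * m"] card_Diff_subset[OF fin, of "carrier (?D \<times>\<times> ?D)"]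
        card_mono[of "carrier (?D \<times>\<times> ?D)" I]
      by (simp add: card_cartesian_product power_mult_distrib)
    moreover have "card (?\<sigma> ` ?L) = card ?L"
      by (rule card_image) (rule inj_on_inverseI[of _ ?\<kappa>], rule \<sigma>(2))
    moreover have "card ?L = (m + 2) ^ 2 - 1"
      by (subst card_Diff_subset) (auto simp: class_labels_def card_cartesian_product power2_eq_square)
    moreover have "card (I - ?\<sigma> ` ?L) = card I - card (?\<sigma> ` ?L)"
    proof (rule card_Diff_subset)
      show "?\<sigma> ` ?L \<subseteq> I"
        using \<sigma>(1) by (rule image_subsetI)
    qed (simp add: class_labels_def)
    ultimately show ?thesis
      by (simp add: power2_eq_square algebra_simps)
  qed
  finally show ?thesis
    using fin unfolding I_def by (simp only: graph_char_poly_eq_char_poly_on)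
qed

text \<open>Serves to replace X and X + 4 by the - X and - X - 4 of the theorem.\<close>

lemma even_power_uminus_mult:
  fixes x y :: "'a :: comm_ring_1"
  assumes "even (j + k)"
  shows "(- x) ^ j * (- y) ^ k = x ^ j * y ^ k"
  using assms by (cases "even j") auto

section \<open>Assembly of the factors and of the spectrum\<close>

theorem theorem3p3:
  fixes n :: nat
  assumes "even n" and "n > 4"
  defines "\<Gamma> \<equiv> non_commuting_graph (dihedral_group n \<times>\<times> dihedral_group n)"
    and "q \<equiv> [:16 * of_nat n * (of_nat n - 2), 0, - (2 * of_nat n + 4), - 1:] :: real poly"
  shows "\<exists>f :: real poly. degree f = 8 \<and>
    graph_char_poly \<Gamma> =
      ([:0, - 1:] ^ (15 * n ^ 2 div 4 - 2 * n - 3) div [:0, - 1:] ^ 4)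
      * [:- 4, - 1:] ^ (n ^ 2 div 4 - n + 1) * q ^ (n - 2) * f \<and>
    (\<forall>(\<gamma> :: nat \<Rightarrow> complex) \<alpha>\<^sub>1 \<alpha>\<^sub>2 \<alpha>\<^sub>3.
      proots (map_poly complex_of_real f) = image_mset \<gamma> (mset_set {1..8}) \<longrightarrow>
      proots (map_poly complex_of_real q) = {#\<alpha>\<^sub>1, \<alpha>\<^sub>2, \<alpha>\<^sub>3#} \<longrightarrow>
      graph_spectrum \<Gamma> =
        replicate_mset (n ^ 2 div 4 - n + 1) (- 4)
        + replicate_mset (15 * n ^ 2 div 4 - 2 * n - 7) 0
        + replicate_mset (n - 2) \<alpha>\<^sub>1
        + replicate_mset (n - 2) \<alpha>\<^sub>2
        + replicate_mset (n - 2) \<alpha>\<^sub>3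
        + image_mset \<gamma> (mset_set {1..8}))"
proof -
  obtain m where n: "n = 2 * m"
    using assms(1) by (auto elim: evenE)
  have m: "m \<ge> 3"
    using assms(2) n by simp
  define f where "f = char_poly_on type_pairs (type_pair_mat m)"
  define N where "N = 15 * m ^ 2 - 4 * m - 7"
  define M where "M = (m - 1) ^ 2"
  \<comment> \<open>Guarantees that the natural subtractions in the exponent of X do not
    truncate.\<close>
  have sq: "m ^ 2 \<ge> 3 * m"
    using m by (simp add: power2_eq_square)
  have N: "15 * n ^ 2 div 4 - 2 * n - 3 = N + 4" "15 * n ^ 2 div 4 - 2 * n - 7 = N"
    using m sq by (auto simp: n N_def power_mult_distrib)
  have M: "n ^ 2 div 4 - n + 1 = M"
  proof -
    obtain k where "m = k + 3"
      using m by (metis le_Suc_ex add.commute)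
    then have "m ^ 2 - 2 * m + 1 = M"
      by (simp add: M_def power2_eq_square algebra_simps)
    then show ?thesis
      by (simp add: n power_mult_distrib)
  qed
  \<comment> \<open>Modulo 2, both \<open>N\<close> and \<open>M\<close> are congruent to m +
    1.\<close>
  have NM: "even (N + M)"
    using m sq by (auto simp: N_def M_def)
  have deg: "degree f = 8"
    by (simp add: f_def degree_char_poly_on type_pairs_def card_Diff_subset)
  have q: "cubic m = - q"
    by (simp add: q_def cubic_def n algebra_simps)
  have "graph_char_poly \<Gamma> = f * cubic m ^ (m - 1) * (cubic m * [:4, 1:] ^ (m - 1)) ^ (m - 1) * [:0, 1:] ^ N"
    unfolding \<Gamma>_def n N_def f_def
    by (simp only: graph_char_poly_dihedral_square[OF m] char_poly_on_class_pair_mat[OF m]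
        char_poly_on_mixed_mat[OF m])
  also have "\<dots> = [:0, 1:] ^ N * [:4, 1:] ^ M * cubic m ^ (n - 2) * f"
  proof -
    \<comment> \<open>Each of the two eliminations contributes m - 1 cubic factors.\<close>
    have "n - 2 = (m - 1) + (m - 1)"
      by (simp add: n)
    then show ?thesis
      by (simp only: M_def power_mult_distrib power_add power_mult[symmetric] power2_eq_square mult_ac)
  qed
  also have "[:0, 1:] ^ N * [:4, 1:] ^ M = (- [:0, 1:]) ^ N * (- [:4, 1:] :: real poly) ^ M"
    by (rule even_power_uminus_mult[OF NM, symmetric])
  \<comment> \<open>The sign in \<open>cubic m = - q\<close> disappears because n - 2 is
    even.\<close>
  also have "cubic m ^ (n - 2) = q ^ (n - 2)"
    using assms(1) by (simp add: q)
  finally have P: "graph_char_poly \<Gamma> = [:0, - 1:] ^ N * [:- 4, - 1:] ^ M * q ^ (n - 2) * f"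
    by simp
  have div: "[:0, - 1:] ^ (N + 4) div [:0, - 1:] ^ 4 = ([:0, - 1:] :: real poly) ^ N"
    by (simp add: power_add)
  show ?thesis
  proof (intro exI[of _ f] conjI allI impI)
    show "graph_char_poly \<Gamma> =
      ([:0, - 1:] ^ (15 * n ^ 2 div 4 - 2 * n - 3) div [:0, - 1:] ^ 4)
      * [:- 4, - 1:] ^ (n ^ 2 div 4 - n + 1) * q ^ (n - 2) * f"
      unfolding N M div by (rule P)
    fix \<gamma> :: "nat \<Rightarrow> complex" and \<alpha>\<^sub>1 \<alpha>\<^sub>2 \<alpha>\<^sub>3
    assume f: "proots (map_poly complex_of_real f) = image_mset \<gamma> (mset_set {1..8})"
      and \<alpha>: "proots (map_poly complex_of_real q) = {#\<alpha>\<^sub>1, \<alpha>\<^sub>2, \<alpha>\<^sub>3#}"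
    interpret hom: map_poly_inj_idom_hom complex_of_real ..
    \<comment> \<open>\<open>proots\<close> turns products into sums only for nonzero
      factors.\<close>
    have nz: "f \<noteq> 0" "q \<noteq> 0"
      using deg by (auto simp: q_def)
    have lin: "proots [:- 4, - 1:] = {#- 4 :: complex#}" "proots [:0, - 1:] = {#0 :: complex#}"
      using proots_uminus[of "[:4, 1 :: complex:]"] proots_uminus[of "[:0, 1 :: complex:]"] by simp_all
    have "graph_spectrum \<Gamma> = proots ([:0, - 1:] ^ N * [:- 4, - 1:] ^ M
        * map_poly complex_of_real q ^ (n - 2) * map_poly complex_of_real f)"
      unfolding graph_spectrum_eq_proots P by (simp add: hom_distribs)
    also have "\<dots> = repeat_mset N {#0#} + repeat_mset M {#- 4#} + repeat_mset (n - 2) {#\<alpha>\<^sub>1, \<alpha>\<^sub>2, \<alpha>\<^sub>3#}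
        + image_mset \<gamma> (mset_set {1..8})"
      using nz by (simp add: proots_mult proots_power lin f \<alpha>)
    finally show "graph_spectrum \<Gamma> =
        replicate_mset (n ^ 2 div 4 - n + 1) (- 4)
        + replicate_mset (15 * n ^ 2 div 4 - 2 * n - 7) 0
        + replicate_mset (n - 2) \<alpha>\<^sub>1
        + replicate_mset (n - 2) \<alpha>\<^sub>2
        + replicate_mset (n - 2) \<alpha>\<^sub>3
        + image_mset \<gamma> (mset_set {1..8})"
      unfolding N M by (simp add: ac_simps)
  qed (rule deg)
qed

end
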